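(* Let $CC$ be a C-system and let $i,j\in\mathbb{N}$, $i>0$. One can construct a bijection between the following two sets: (1) the set of functions $F:Ob_{\ge i}\to Ob$ such that (a) for any $X\in Ob_{\ge i}$ one has $ft^j(F(X))=ft^i(X)$, and (b) for any $X\in Ob_{\ge i}$ and $f:\Gamma'\to ft^i(X)$ one has $f^*(F(X))=F(f^*(X))$; (2) the set of morphisms of presheaves $\mathcal{O}b_i\to\mathcal{O}b_j$ on $CC$.
   Context: Composition is written in diagrammatic order: for $f:X\to Y$, $g:Y\to Z$, the composite is $f\circ g:X\to Z$. A C-system $CC$ consists of a category with set of objects $Ob$ and set of morphisms $Mor$, functions $l:Ob\to\mathbb{N}$ and $ft:Ob\to Ob$, an object $pt$, for each $X$ a morphism $p_X:X\to ft(X)$, and for each $X$ with $l(X)>0$ and each $f:Y\to ft(X)$ an object $f^*(X)$ and a morphism $q(f,X):f^*(X)\to X$, such that: $l^{-1}(0)=\{pt\}$; $l(ft(X))=l(X)-1$ if $l(X)>0$; $ft(pt)=pt$; $pt$ is a final object; if $l(X)>0$ and $f:Y\to ft(X)$, then $l(f^*(X))>0$, $ft(f^*(X))=Y$, $p_{f^*(X)}\circ f=q(f,X)\circ p_X$ and this square is a pullback; $Id_{ft(X)}^*(X)=X$ and $q(Id_{ft(X)},X)=Id_X$; for $g:Z\to Y$ and $f:Y\to ft(X)$, $(g\circ f)^*(X)=g^*(f^*(X))$ and $q(g\circ f,X)=q(g,f^*(X))\circ q(f,X)$. $X\ge Y$ ("$X$ is over $Y$") means $l(X)\ge l(Y)$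 and $Y=ft^{l(X)-l(Y)}(X)$; $X>Y$ means $X\ge Y$ and $l(X)>l(Y)$. For $X\ge\Gamma$ and $f:\Gamma'\to\Gamma$, $f^*(X)$ and $q(f,X):f^*(X)\to X$ are defined recursively by $f^*(\Gamma)=\Gamma'$, $q(f,\Gamma)=f$, and, for $X>\Gamma$, $f^*(X)=q(f,ft(X))^*(X)$, $q(f,X)=q(q(f,ft(X)),X)$. $Ob_{\ge i}=\{X\in Ob\mid l(X)\ge i\}$. The presheaf $\mathcal{O}b_n$ on $CC$ is given by $\mathcal{O}b_n(\Gamma)=\{X\in Ob\mid l(X)=l(\Gamma)+n,\ ft^n(X)=\Gamma\}$, with restriction along $f:\Gamma'\to\Gamma$ given by $X\mapsto f^*(X)$. *)

theory Defs
  imports Main "HOL-Library.FuncSet"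
begin

(* Composition is diagrammatic: "dcomp CC f g", written f \<cdot> g, goes from src f to tgt g. *)

record ('o, 'm) csys =
  Ob :: "'o set"
  Mor :: "'m set"
  src :: "'m \<Rightarrow> 'o"
  tgt :: "'m \<Rightarrow> 'o"
  ident :: "'o \<Rightarrow> 'm"
  dcomp :: "'m \<Rightarrow> 'm \<Rightarrow> 'm" (infixl "\<cdot>\<index>" 70)
  len :: "'o \<Rightarrow> nat"
  ft :: "'o \<Rightarrow> 'o"
  pt :: 'o
  proj :: "'o \<Rightarrow> 'm"
  pb :: "'m \<Rightarrow> 'o \<Rightarrow> 'o"
  qmor :: "'m \<Rightarrow> 'o \<Rightarrow> 'm"

definition hom :: "('o, 'm, 'z) csys_scheme \<Rightarrow> 'o \<Rightarrow> 'o \<Rightarrow> 'm set" where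
  "hom C X Y = {f \<in> Mor C. src C f = X \<and> tgt C f = Y}"

locale category =
  fixes C (structure)
  assumes src_closed: "f \<in> Mor C \<Longrightarrow> src C f \<in> Ob C"
    and tgt_closed: "f \<in> Mor C \<Longrightarrow> tgt C f \<in> Ob C"
    and ident_hom: "X \<in> Ob C \<Longrightarrow> ident C X \<in> hom C X X"
    and dcomp_hom: "\<lbrakk>f \<in> hom C X Y; g \<in> hom C Y Z\<rbrakk> \<Longrightarrow> f \<cdot> g \<in> hom C X Z"
    and ident_left: "f \<in> hom C X Y \<Longrightarrow> ident C X \<cdot> f = f"
    and ident_right: "f \<in> hom C X Y \<Longrightarrow> f \<cdot> ident C Y = f"
    and dcomp_assoc: "\<lbrakk>f \<in> hom C W X; g \<in> hom C X Y; h \<in> hom C Y Z\<rbrakk>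
          \<Longrightarrow> (f \<cdot> g) \<cdot> h = f \<cdot> (g \<cdot> h)"

(* The square with a : P -> Y, b : P -> X, f : Y -> B, g : X -> B. *)
definition is_pullback :: "('o, 'm, 'z) csys_scheme \<Rightarrow> 'm \<Rightarrow> 'm \<Rightarrow> 'm \<Rightarrow> 'm \<Rightarrow> bool" where
  "is_pullback C a b f g \<longleftrightarrow>
     a \<in> Mor C \<and> b \<in> Mor C \<and> f \<in> Mor C \<and> g \<in> Mor C \<and>
     src C a = src C b \<and> tgt C a = src C f \<and> tgt C b = src C g \<and> tgt C f = tgt C g \<and>
     dcomp C a f = dcomp C b g \<and>
     (\<forall>W \<in> Ob C. \<forall>u \<in> hom C W (src C f). \<forall>v \<in> hom C W (src C g).
        dcomp C u f = dcomp C v g \<longrightarrow>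
        (\<exists>!h. h \<in> hom C W (src C a) \<and> dcomp C h a = u \<and> dcomp C h b = v))"

locale C_system = category C for C (structure) +
  assumes ft_closed: "X \<in> Ob C \<Longrightarrow> ft C X \<in> Ob C"
    and proj_hom: "X \<in> Ob C \<Longrightarrow> proj C X \<in> hom C X (ft C X)"
    and pb_closed: "\<lbrakk>X \<in> Ob C; len C X > 0; f \<in> hom C Y (ft C X)\<rbrakk> \<Longrightarrow> pb C f X \<in> Ob C"
    and qmor_hom: "\<lbrakk>X \<in> Ob C; len C X > 0; f \<in> hom C Y (ft C X)\<rbrakk>
          \<Longrightarrow> qmor C f X \<in> hom C (pb C f X) X"
    and len_zero: "{X \<in> Ob C. len C X = 0} = {pt C}"
    and len_ft: "\<lbrakk>X \<in> Ob C; len C X > 0\<rbrakk> \<Longrightarrow> len C (ft C X) = len C X - 1"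
    and ft_pt: "ft C (pt C) = pt C"
    and pt_final: "X \<in> Ob C \<Longrightarrow> \<exists>!f. f \<in> hom C X (pt C)"
    and len_pb: "\<lbrakk>X \<in> Ob C; len C X > 0; f \<in> hom C Y (ft C X)\<rbrakk> \<Longrightarrow> len C (pb C f X) > 0"
    and ft_pb: "\<lbrakk>X \<in> Ob C; len C X > 0; f \<in> hom C Y (ft C X)\<rbrakk> \<Longrightarrow> ft C (pb C f X) = Y"
    and pb_pullback: "\<lbrakk>X \<in> Ob C; len C X > 0; f \<in> hom C Y (ft C X)\<rbrakk>
          \<Longrightarrow> is_pullback C (proj C (pb C f X)) (qmor C f X) f (proj C X)"
    and pb_ident: "\<lbrakk>X \<in> Ob C; len C X > 0\<rbrakk> \<Longrightarrow> pb C (ident C (ft C X)) X = X"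
    and qmor_ident: "\<lbrakk>X \<in> Ob C; len C X > 0\<rbrakk> \<Longrightarrow> qmor C (ident C (ft C X)) X = ident C X"
    and pb_dcomp: "\<lbrakk>X \<in> Ob C; len C X > 0; g \<in> hom C Z Y; f \<in> hom C Y (ft C X)\<rbrakk>
          \<Longrightarrow> pb C (g \<cdot> f) X = pb C g (pb C f X)"
    and qmor_dcomp: "\<lbrakk>X \<in> Ob C; len C X > 0; g \<in> hom C Z Y; f \<in> hom C Y (ft C X)\<rbrakk>
          \<Longrightarrow> qmor C (g \<cdot> f) X = qmor C g (pb C f X) \<cdot> qmor C f X"

definition over :: "('o, 'm, 'z) csys_scheme \<Rightarrow> 'o \<Rightarrow> 'o \<Rightarrow> bool" where
  "over C X Y \<longleftrightarrow> len C X \<ge> len C Y \<and> Y = (ft C ^^ (len C X - len C Y)) X"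

(* The extensions of q(f,X) and f^*(X) to all X over the target of f.  The recursion descends
   along ft, so q_iter carries the number len X - len (tgt f) of steps; the recursion equations
   without this counter are the lemmas q_ext_step and star_step below.  The values at X that are
   not over tgt f are irrelevant. *)
primrec q_iter :: "('o, 'm, 'z) csys_scheme \<Rightarrow> 'm \<Rightarrow> nat \<Rightarrow> 'o \<Rightarrow> 'm" where
  "q_iter C f 0 X = f"
| "q_iter C f (Suc n) X = qmor C (q_iter C f n (ft C X)) X"

definition q_ext :: "('o, 'm, 'z) csys_scheme \<Rightarrow> 'm \<Rightarrow> 'o \<Rightarrow> 'm" where
  "q_ext C f X = q_iter C f (len C X - len C (tgt C f)) X"

definition star :: "('o, 'm, 'z) csys_scheme \<Rightarrow> 'm \<Rightarrow> 'o \<Rightarrow> 'o" where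
  "star C f X = (if X = tgt C f then src C f else pb C (q_ext C f (ft C X)) X)"

definition Ob_ge :: "('o, 'm, 'z) csys_scheme \<Rightarrow> nat \<Rightarrow> 'o set" where
  "Ob_ge C i = {X \<in> Ob C. len C X \<ge> i}"

record ('o, 'm, 'a) presheaf_data =
  sections :: "'o \<Rightarrow> 'a set"
  restr :: "'m \<Rightarrow> 'a \<Rightarrow> 'a"

definition is_presheaf ::
    "('o, 'm, 'z) csys_scheme \<Rightarrow> ('o, 'm, 'a) presheaf_data \<Rightarrow> bool" where
  "is_presheaf C P \<longleftrightarrow>
     (\<forall>f \<in> Mor C. \<forall>x \<in> sections P (tgt C f). restr P f x \<in> sections P (src C f)) \<and>
     (\<forall>\<Gamma> \<in> Ob C. \<forall>x \<in> sections P \<Gamma>. restr P (ident C \<Gamma>) x = x) \<and>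
     (\<forall>g \<in> Mor C. \<forall>f \<in> Mor C. tgt C g = src C f \<longrightarrow>
        (\<forall>x \<in> sections P (tgt C f). restr P (dcomp C g f) x = restr P g (restr P f x)))"

(* Extensional function spaces make equality of families of components the equality of functions
   on the actual domains. *)
definition presheaf_morphisms ::
    "('o, 'm, 'z) csys_scheme \<Rightarrow> ('o, 'm, 'a) presheaf_data \<Rightarrow> ('o, 'm, 'b) presheaf_data
      \<Rightarrow> ('o \<Rightarrow> 'a \<Rightarrow> 'b) set" where
  "presheaf_morphisms C P Q =
     {\<alpha> \<in> (\<Pi>\<^sub>E \<Gamma> \<in> Ob C. sections P \<Gamma> \<rightarrow>\<^sub>E sections Q \<Gamma>).
        \<forall>f \<in> Mor C. \<forall>x \<in> sections P (tgt C f).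
          \<alpha> (src C f) (restr P f x) = restr Q f (\<alpha> (tgt C f) x)}"

definition Ob_presheaf :: "('o, 'm, 'z) csys_scheme \<Rightarrow> nat \<Rightarrow> ('o, 'm, 'o) presheaf_data" where
  "Ob_presheaf C n =
     \<lparr>sections = (\<lambda>\<Gamma>. {X \<in> Ob C. len C X = len C \<Gamma> + n \<and> (ft C ^^ n) X = \<Gamma>}),
      restr = star C\<rparr>"

definition Ob_operations :: "('o, 'm, 'z) csys_scheme \<Rightarrow> nat \<Rightarrow> nat \<Rightarrow> ('o \<Rightarrow> 'o) set" where
  "Ob_operations C i j =
     {F \<in> Ob_ge C i \<rightarrow>\<^sub>E Ob C.
        (\<forall>X \<in> Ob_ge C i. (ft C ^^ j) (F X) = (ft C ^^ i) X) \<and>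
        (\<forall>X \<in> Ob_ge C i. \<forall>\<Gamma>' \<in> Ob C. \<forall>f \<in> hom C \<Gamma>' ((ft C ^^ i) X).
           star C f (F X) = F (star C f X))}"

context C_system
begin

lemma q_ext_base: "q_ext C f (tgt C f) = f"
  by (simp add: q_ext_def)

lemma star_base: "star C f (tgt C f) = src C f"
  by (simp add: star_def)

lemma q_ext_step:
  assumes "X \<in> Ob C" "over C X (tgt C f)" "X \<noteq> tgt C f"
  shows "q_ext C f X = qmor C (q_ext C f (ft C X)) X"
proof -
  from assms(2,3) have "len C X > len C (tgt C f)"
    by (cases "len C X = len C (tgt C f)") (auto simp: over_def)
  then obtain n where n: "len C X = Suc (len C (tgt C f) + n)"
    by (auto dest: less_imp_Suc_add)
  with len_ft[OF assms(1)] have "len C (ft C X) = len C (tgt C f) + n" by simp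
  then show ?thesis using n by (simp add: q_ext_def Suc_diff_le)
qed

lemma star_step: "X \<noteq> tgt C f \<Longrightarrow> star C f X = pb C (q_ext C f (ft C X)) X"
  by (simp add: star_def)

abbreviation "Sec n \<Gamma> \<equiv> sections (Ob_presheaf C n) \<Gamma>"

lemma Sec_iff: "X \<in> Sec n \<Gamma> \<longleftrightarrow> X \<in> Ob C \<and> len C X = len C \<Gamma> + n \<and> (ft C ^^ n) X = \<Gamma>"
  by (simp add: Ob_presheaf_def)

lemma Sec_Suc:
  assumes "X \<in> Sec (Suc n) \<Gamma>"
  shows "ft C X \<in> Sec n \<Gamma>" "X \<in> Ob C" "len C X > 0" "X \<noteq> \<Gamma>"
proof -
  from assms have X: "X \<in> Ob C" "len C X = Suc (len C \<Gamma> + n)" "(ft C ^^ n) (ft C X) = \<Gamma>"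
    by (auto simp: Sec_iff funpow_swap1)
  then show "ft C X \<in> Sec n \<Gamma>" "X \<in> Ob C" "len C X > 0" "X \<noteq> \<Gamma>"
    using len_ft[of X] ft_closed[of X] by (auto simp: Sec_iff)
qed

lemma Sec_SucI:
  assumes "X \<in> Ob C" "len C X > 0" "ft C X \<in> Sec n \<Gamma>"
  shows "X \<in> Sec (Suc n) \<Gamma>"
  using assms len_ft[of X]
  by (auto simp: Sec_iff funpow_swap1)

lemma q_ext_Suc:
  assumes "X \<in> Sec (Suc n) (tgt C f)"
  shows "q_ext C f X = qmor C (q_ext C f (ft C X)) X"
  using assms by (intro q_ext_step Sec_Suc(2,4)[OF assms]) (auto simp: over_def Sec_iff)

lemma q_ext_star:
  assumes f: "f \<in> Mor C"
  shows "X \<in> Sec n (tgt C f) \<Longrightarrow> q_ext C f X \<in> hom C (star C f X) X \<and> star C f X \<in> Sec n (src C f)"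
proof (induction n arbitrary: X)
  case 0
  then have "X = tgt C f" by (simp add: Sec_iff)
  then show ?case using f by (simp add: q_ext_base star_base hom_def Sec_iff src_closed)
next
  case (Suc n)
  note S = Sec_Suc[OF Suc.prems]
  from Suc.IH[OF S(1)] have h: "q_ext C f (ft C X) \<in> hom C (star C f (ft C X)) (ft C X)"
    and s: "star C f (ft C X) \<in> Sec n (src C f)" by auto
  have "pb C (q_ext C f (ft C X)) X \<in> Sec (Suc n) (src C f)"
    using S(2,3) h s by (intro Sec_SucI) (simp_all add: pb_closed len_pb ft_pb)
  then show ?case using qmor_hom[OF S(2,3) h]
    by (simp add: q_ext_Suc[OF Suc.prems] star_step[OF S(4)])
qed

lemma ident_ext:
  assumes "\<Gamma> \<in> Ob C"
  shows "X \<in> Sec n \<Gamma> \<Longrightarrow> star C (ident C \<Gamma>) X = X \<and> q_ext C (ident C \<Gamma>) X = ident C X"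
proof (induction n arbitrary: X)
  case 0
  have t: "tgt C (ident C \<Gamma>) = \<Gamma>" "src C (ident C \<Gamma>) = \<Gamma>"
    using ident_hom[OF assms] by (auto simp: hom_def)
  from 0 have "X = \<Gamma>" by (simp add: Sec_iff)
  then show ?case
    using q_ext_base[of "ident C \<Gamma>"] star_base[of "ident C \<Gamma>"] by (simp add: t)
next
  case (Suc n)
  have t: "tgt C (ident C \<Gamma>) = \<Gamma>"
    using ident_hom[OF assms] by (auto simp: hom_def)
  note S = Sec_Suc[OF Suc.prems]
  show ?case
    using Suc.IH[OF S(1)] S Suc.prems
    by (simp add: q_ext_Suc[of X n] star_step t pb_ident qmor_ident)
qed

lemma dcomp_ext:
  assumes g: "g \<in> hom C Z Y" and f: "f \<in> hom C Y \<Gamma>"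
  shows "X \<in> Sec n \<Gamma> \<Longrightarrow> star C (g \<cdot> f) X = star C g (star C f X) \<and>
           q_ext C (g \<cdot> f) X = q_ext C g (star C f X) \<cdot> q_ext C f X"
proof (induction n arbitrary: X)
  case 0
  have t: "src C (g \<cdot> f) = Z" "tgt C (g \<cdot> f) = \<Gamma>"
    using dcomp_hom[OF g f] by (auto simp: hom_def)
  have u: "src C g = Z" "tgt C g = Y" "src C f = Y" "tgt C f = \<Gamma>"
    using f g by (auto simp: hom_def)
  from 0 have "X = \<Gamma>" by (simp add: Sec_iff)
  then show ?case
    using q_ext_base[of "g \<cdot> f"] star_base[of "g \<cdot> f"]
      q_ext_base[of f] star_base[of f] q_ext_base[of g] star_base[of g]
    by (simp add: t u)
next
  case (Suc n)
  have t: "tgt C (g \<cdot> f) = \<Gamma>" using dcomp_hom[OF g f] by (auto simp: hom_def)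
  have u: "g \<in> Mor C" "f \<in> Mor C" "tgt C g = Y" "src C f = Y" "tgt C f = \<Gamma>"
    using f g by (auto simp: hom_def)
  note S = Sec_Suc[OF Suc.prems]
  let ?T = "star C f (ft C X)"
  have F: "q_ext C f (ft C X) \<in> hom C ?T (ft C X)" "?T \<in> Sec n Y"
    using q_ext_star[OF u(2), of "ft C X" n] S(1) u by auto
  have G: "q_ext C g ?T \<in> hom C (star C g ?T) ?T"
    using q_ext_star[OF u(1), of ?T n] F(2) u by auto
  have X: "star C f X \<in> Sec (Suc n) Y"
    using q_ext_star[OF u(2), of X "Suc n"] Suc.prems u by auto
  note SX = Sec_Suc[OF X]
  have e: "star C f X = pb C (q_ext C f (ft C X)) X"
    using star_step[of X f] S(4) u by simp
  have ft: "ft C (star C f X) = ?T" using ft_pb[OF S(2,3) F(1)] e by simp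
  have q1: "q_ext C (g \<cdot> f) X = qmor C (q_ext C (g \<cdot> f) (ft C X)) X"
    using q_ext_Suc[of X n] Suc.prems t by simp
  have q2: "q_ext C f X = qmor C (q_ext C f (ft C X)) X"
    using q_ext_Suc[of X n] Suc.prems u by simp
  have q3: "q_ext C g (star C f X) = qmor C (q_ext C g ?T) (star C f X)"
    using q_ext_Suc[of "star C f X" n g] X u ft by simp
  have s1: "star C (g \<cdot> f) X = pb C (q_ext C (g \<cdot> f) (ft C X)) X"
    using star_step[of X "g \<cdot> f"] S(4) t by simp
  have s2: "star C g (star C f X) = pb C (q_ext C g ?T) (star C f X)"
    using star_step[of "star C f X" g] SX(4) u ft by simp
  have IH: "q_ext C (g \<cdot> f) (ft C X) = q_ext C g ?T \<cdot> q_ext C f (ft C X)"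
    using Suc.IH[OF S(1)] by simp
  show ?case
    using pb_dcomp[OF S(2,3) G F(1)] qmor_dcomp[OF S(2,3) G F(1)]
    by (simp add: q1 q2 q3 s1 s2 IH flip: e)
qed

lemma Ob_presheaf_is_presheaf: "is_presheaf C (Ob_presheaf C n)"
proof -
  have r: "restr (Ob_presheaf C n) = star C" by (simp add: Ob_presheaf_def)
  show ?thesis
    unfolding is_presheaf_def r
  proof (intro conjI ballI impI)
    fix f X assume "f \<in> Mor C" "X \<in> Sec n (tgt C f)"
    then show "star C f X \<in> Sec n (src C f)" using q_ext_star by blast
  next
    fix \<Gamma> X assume "\<Gamma> \<in> Ob C" "X \<in> Sec n \<Gamma>"
    then show "star C (ident C \<Gamma>) X = X" using ident_ext by blast
  next
    fix g f X assume "g \<in> Mor C" "f \<in> Mor C" "tgt C g = src C f" "X \<in> Sec n (tgt C f)"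
    then show "star C (g \<cdot> f) X = star C g (star C f X)"
      using dcomp_ext[of g "src C g" "src C f" f "tgt C f" X n] by (simp add: hom_def)
  qed
qed

end

end

theory Submission
  imports Defs
begin

text \<open>
  An object \<open>X\<close> of length at least \<open>i\<close> is a section of \<open>\<O>b\<^sub>i\<close> over exactly one object, namely
  \<open>ft\<^sup>i(X)\<close>.  A family of components \<open>\<alpha>\<^sub>\<Gamma>\<close> on the sections of \<open>\<O>b\<^sub>i\<close> is therefore the same thing as
  one function \<open>F\<close> on all objects of length at least \<open>i\<close>: cut \<open>F\<close> into its restrictions to the
  fibres of \<open>ft\<^sup>i\<close>, or glue the components along \<open>F(X) = \<alpha>\<^bsub>ft\<^sup>i(X)\<^esub>(X)\<close>.  Naturality of the components is
  condition (b) on \<open>F\<close>.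

  The one point with content is that \<open>F\<close> lands in \<open>\<O>b\<^sub>j\<close>.  Condition (a) says
  \<open>ft\<^sup>j(F(X)) = ft\<^sup>i(X)\<close>, but since \<open>ft(pt) = pt\<close> this determines the length of \<open>F(X)\<close> only if
  \<open>ft\<^sup>i(X)\<close> is not \<open>pt\<close>; over \<open>pt\<close> it allows every length up to \<open>j\<close>.  There the length is
  recovered from (b): pull back along the morphism \<open>f : X \<rightarrow> pt\<close>.  Pullback preserves relative length,
  so \<open>f\<^sup>*(F(X))\<close> has the relative length of \<open>F(X)\<close>, while \<open>f\<^sup>*(F(X)) = F(f\<^sup>*(X))\<close> lies
  over \<open>X\<close>, which has positive length because \<open>i > 0\<close>, and so has relative length \<open>j\<close>.  This is lemma
  \<open>operation_in_Sec\<close>.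
\<close>

context C_system
begin

lemma ft_pow_closed: "X \<in> Ob C \<Longrightarrow> (ft C ^^ n) X \<in> Ob C"
  by (induction n) (auto simp: ft_closed)

lemma len_pt: "len C (pt C) = 0"
  using len_zero by auto

lemma len_zero_imp_pt: "X \<in> Ob C \<Longrightarrow> len C X = 0 \<Longrightarrow> X = pt C"
  using len_zero by auto

lemma len_ft_pow: "X \<in> Ob C \<Longrightarrow> len C ((ft C ^^ n) X) = len C X - n"
proof (induction n)
  case (Suc n)
  let ?Y = "(ft C ^^ n) X"
  have Y: "?Y \<in> Ob C" using Suc.prems by (rule ft_pow_closed)
  show ?case
  proof (cases "len C ?Y = 0")
    case True
    then have "?Y = pt C" using Y by (rule len_zero_imp_pt[rotated])
    then show ?thesis using True Suc by (simp add: ft_pt len_pt)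
  next
    case False
    then show ?thesis using Suc len_ft[OF Y] by simp
  qed
qed simp

lemma Sec_iff_Ob_ge: "X \<in> Sec i \<Gamma> \<longleftrightarrow> X \<in> Ob_ge C i \<and> (ft C ^^ i) X = \<Gamma>"
  using len_ft_pow[of X i] by (auto simp: Sec_iff Ob_ge_def)

lemma Sec_self: "X \<in> Ob_ge C i \<Longrightarrow> X \<in> Sec i ((ft C ^^ i) X)"
  by (simp add: Sec_iff_Ob_ge)

lemma star_Sec: "f \<in> Mor C \<Longrightarrow> X \<in> Sec n (tgt C f) \<Longrightarrow> star C f X \<in> Sec n (src C f)"
  using q_ext_star by blast

lemma Sec_of_pos_len:
  assumes "Y \<in> Ob C" "(ft C ^^ j) Y = \<Gamma>" "len C \<Gamma> > 0"
  shows "Y \<in> Sec j \<Gamma>"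
  using assms len_ft_pow[OF assms(1), of j] by (auto simp: Sec_iff)

lemma operationD:
  assumes "F \<in> Ob_operations C i j" "X \<in> Ob_ge C i"
  shows "F X \<in> Ob C" "(ft C ^^ j) (F X) = (ft C ^^ i) X"
  using assms by (auto simp: Ob_operations_def)

lemma operation_natural:
  assumes "F \<in> Ob_operations C i j" "f \<in> Mor C" "X \<in> Sec i (tgt C f)"
  shows "F (star C f X) = star C f (F X)"
proof -
  have "X \<in> Ob_ge C i" "f \<in> hom C (src C f) ((ft C ^^ i) X)" "src C f \<in> Ob C"
    using assms by (auto simp: Sec_iff_Ob_ge hom_def src_closed)
  then show ?thesis using assms(1) unfolding Ob_operations_def by fastforce
qed

text \<open>Over \<open>pt\<close> the length of \<open>F(X)\<close> is read off after pulling back to a context of positive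
  length; \<open>X\<close> itself is such a context, and its morphism to \<open>pt\<close> is available by finality.\<close>

lemma operation_in_Sec:
  assumes F: "F \<in> Ob_operations C i j" and i: "i > 0" and X: "X \<in> Sec i \<Gamma>"
  shows "F X \<in> Sec j \<Gamma>"
proof (cases "len C \<Gamma> = 0")
  case False
  then show ?thesis
    using operationD[OF F, of X] X by (intro Sec_of_pos_len) (auto simp: Sec_iff_Ob_ge)
next
  case True
  have X': "X \<in> Ob_ge C i" "X \<in> Ob C" and \<Gamma>: "(ft C ^^ i) X = \<Gamma>" and lX: "len C X > 0"
    using X i by (auto simp: Sec_iff_Ob_ge Ob_ge_def)
  have pt: "\<Gamma> = pt C" using True \<Gamma> X' ft_pow_closed len_zero_imp_pt by blast
  obtain f where f: "f \<in> Mor C" "src C f = X" "tgt C f = \<Gamma>"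
    using pt_final[OF X'(2)] pt by (auto simp: hom_def)
  note FX = operationD[OF F X'(1)]
  define k where "k = len C (F X)"
  have "len C ((ft C ^^ k) (F X)) = 0"
    using len_ft_pow[OF FX(1)] by (simp add: k_def)
  then have "(ft C ^^ k) (F X) = \<Gamma>"
    using FX(1) ft_pow_closed len_zero_imp_pt pt by blast
  then have "F X \<in> Sec k (tgt C f)"
    using FX(1) True by (simp add: Sec_iff f k_def)
  then have k: "star C f (F X) \<in> Sec k X" using star_Sec f by metis
  have fX: "star C f X \<in> Sec i X" using star_Sec[of f X i] X f by simp
  then have "F (star C f X) \<in> Sec j X"
    using operationD[OF F, of "star C f X"] lX
    by (intro Sec_of_pos_len) (auto simp: Sec_iff_Ob_ge)
  moreover have "F (star C f X) = star C f (F X)"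
    using operation_natural[OF F f(1)] X f by simp
  ultimately have "k = j" using k by (simp add: Sec_iff)
  then show ?thesis using \<open>F X \<in> Sec k (tgt C f)\<close> f by simp
qed

definition fibrewise :: "nat \<Rightarrow> ('a \<Rightarrow> 'a) \<Rightarrow> 'a \<Rightarrow> 'a \<Rightarrow> 'a" where
  "fibrewise i F = (\<lambda>\<Gamma>\<in>Ob C. \<lambda>X\<in>Sec i \<Gamma>. F X)"

definition glued :: "nat \<Rightarrow> ('a \<Rightarrow> 'a \<Rightarrow> 'a) \<Rightarrow> 'a \<Rightarrow> 'a" where
  "glued i \<alpha> = (\<lambda>X\<in>Ob_ge C i. \<alpha> ((ft C ^^ i) X) X)"

lemma fibrewise_apply: "\<Gamma> \<in> Ob C \<Longrightarrow> X \<in> Sec i \<Gamma> \<Longrightarrow> fibrewise i F \<Gamma> X = F X"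
  by (simp add: fibrewise_def)

lemma glued_apply: "X \<in> Sec i \<Gamma> \<Longrightarrow> glued i \<alpha> X = \<alpha> \<Gamma> X"
  by (simp add: glued_def Sec_iff_Ob_ge)

lemma restr_Ob_presheaf: "restr (Ob_presheaf C n) = star C"
  by (simp add: Ob_presheaf_def)

lemma fibrewise_morphism:
  assumes F: "F \<in> Ob_operations C i j" and i: "i > 0"
  shows "fibrewise i F \<in> presheaf_morphisms C (Ob_presheaf C i) (Ob_presheaf C j)"
proof -
  have "fibrewise i F \<in> (\<Pi>\<^sub>E \<Gamma> \<in> Ob C. Sec i \<Gamma> \<rightarrow>\<^sub>E Sec j \<Gamma>)"
    using operation_in_Sec[OF F i] by (auto simp: fibrewise_def)
  moreover have "fibrewise i F (src C f) (star C f X) = star C f (fibrewise i F (tgt C f) X)"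
    if "f \<in> Mor C" "X \<in> Sec i (tgt C f)" for f X
    using that operation_natural[OF F that]
    by (simp add: fibrewise_apply src_closed tgt_closed star_Sec)
  ultimately show ?thesis
    by (simp add: presheaf_morphisms_def restr_Ob_presheaf)
qed

lemma glued_operation:
  assumes \<alpha>: "\<alpha> \<in> presheaf_morphisms C (Ob_presheaf C i) (Ob_presheaf C j)"
  shows "glued i \<alpha> \<in> Ob_operations C i j"
proof -
  have nat: "\<alpha> (src C f) (star C f X) = star C f (\<alpha> (tgt C f) X)"
    if "f \<in> Mor C" "X \<in> Sec i (tgt C f)" for f X
    using \<alpha> that by (simp add: presheaf_morphisms_def restr_Ob_presheaf)
  have comp: "\<alpha> \<in> (\<Pi>\<^sub>E \<Gamma> \<in> Ob C. Sec i \<Gamma> \<rightarrow>\<^sub>E Sec j \<Gamma>)"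
    using \<alpha> by (simp add: presheaf_morphisms_def)
  have val: "glued i \<alpha> X \<in> Sec j ((ft C ^^ i) X)" if X: "X \<in> Ob_ge C i" for X
  proof -
    have "(ft C ^^ i) X \<in> Ob C" using X by (simp add: Ob_ge_def ft_pow_closed)
    then have "\<alpha> ((ft C ^^ i) X) X \<in> Sec j ((ft C ^^ i) X)"
      using comp Sec_self[OF X] by (blast dest: PiE_mem)
    then show ?thesis using X by (simp add: glued_def)
  qed
  have "star C f (glued i \<alpha> X) = glued i \<alpha> (star C f X)"
    if "X \<in> Ob_ge C i" "f \<in> hom C \<Gamma>' ((ft C ^^ i) X)" for X \<Gamma>' f
  proof -
    have f: "f \<in> Mor C" and X: "X \<in> Sec i (tgt C f)"
      using that Sec_self by (auto simp: hom_def)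
    show ?thesis
      using nat[OF f X] glued_apply[OF X] glued_apply[OF star_Sec[OF f X]] by simp
  qed
  moreover have "glued i \<alpha> \<in> Ob_ge C i \<rightarrow>\<^sub>E Ob C"
    using val by (intro PiE_I) (auto simp: Sec_iff glued_def)
  ultimately show ?thesis
    using val by (simp add: Ob_operations_def Sec_iff)
qed

lemma glued_fibrewise:
  assumes "F \<in> Ob_operations C i j"
  shows "glued i (fibrewise i F) = F"
proof (rule PiE_ext)
  show F: "F \<in> Ob_ge C i \<rightarrow>\<^sub>E Ob C" using assms by (simp add: Ob_operations_def)
  show eq: "glued i (fibrewise i F) X = F X" if "X \<in> Ob_ge C i" for X
    using that Sec_self[OF that]
    by (simp add: glued_def fibrewise_apply ft_pow_closed Ob_ge_def)
  show "glued i (fibrewise i F) \<in> Ob_ge C i \<rightarrow>\<^sub>E Ob C"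
    using F eq by (intro PiE_I) (auto simp: glued_def)
qed

lemma fibrewise_glued:
  assumes "\<alpha> \<in> presheaf_morphisms C (Ob_presheaf C i) (Ob_presheaf C j)"
  shows "fibrewise i (glued i \<alpha>) = \<alpha>"
proof -
  have comp: "\<alpha> \<in> (\<Pi>\<^sub>E \<Gamma> \<in> Ob C. Sec i \<Gamma> \<rightarrow>\<^sub>E Sec j \<Gamma>)"
    using assms by (simp add: presheaf_morphisms_def)
  show ?thesis
  proof (intro ext)
    fix \<Gamma> X
    show "fibrewise i (glued i \<alpha>) \<Gamma> X = \<alpha> \<Gamma> X"
    proof (cases "\<Gamma> \<in> Ob C")
      case True
      then have "\<alpha> \<Gamma> \<in> Sec i \<Gamma> \<rightarrow>\<^sub>E Sec j \<Gamma>" using comp by (rule PiE_mem[rotated])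
      then show ?thesis
        using True PiE_arb[of "\<alpha> \<Gamma>" "Sec i \<Gamma>" _ X]
        by (cases "X \<in> Sec i \<Gamma>") (auto simp: fibrewise_def glued_apply)
    next
      case False
      then show ?thesis using PiE_arb[OF comp False] by (simp add: fibrewise_def)
    qed
  qed
qed

lemma bij_betw_fibrewise:
  assumes "i > 0"
  shows "bij_betw (fibrewise i) (Ob_operations C i j)
           (presheaf_morphisms C (Ob_presheaf C i) (Ob_presheaf C j))"
proof (rule bij_betwI)
  show "fibrewise i \<in> Ob_operations C i j
          \<rightarrow> presheaf_morphisms C (Ob_presheaf C i) (Ob_presheaf C j)"
    using fibrewise_morphism[OF _ assms] by (intro Pi_I)
  show "glued i \<in> presheaf_morphisms C (Ob_presheaf C i) (Ob_presheaf C j)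
          \<rightarrow> Ob_operations C i j"
    by (intro Pi_I glued_operation)
qed (fact glued_fibrewise, fact fibrewise_glued)

end

theorem mainTheorem2:
  fixes CC :: "('o, 'm) csys" and i j :: nat
  assumes "C_system CC" and "i > 0"
  shows "\<exists>\<Phi>. bij_betw \<Phi> (Ob_operations CC i j)
                (presheaf_morphisms CC (Ob_presheaf CC i) (Ob_presheaf CC j)) \<and>
             (\<forall>F \<in> Ob_operations CC i j. \<forall>\<Gamma> \<in> Ob CC.
                \<forall>X \<in> sections (Ob_presheaf CC i) \<Gamma>. \<Phi> F \<Gamma> X = F X)"
proof -
  interpret C_system CC by fact
  show ?thesis
    by (intro exI[of _ "fibrewise i"] conjI ballI bij_betw_fibrewise[OF assms(2)] fibrewise_apply)
qed

end
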